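(* Let $n\geq 2$ be an integer and let $S$ be a sequence in $\mathbb Z_n$. The following are equivalent: (a) $S$ is a $D$-extremal sequence for $(\{1\},\{1\})$; (b) $S$ is an $E$-extremal sequence for $(\{1\},\{1\})$; (c) $S$ is an $E$-extremal sequence for $\{1\}$; (d) $S$ is a translate of a sequence which is equivalent to the sequence $(0,\ldots,0,1,\ldots,1)$ consisting of $n-1$ zeroes followed by $n-1$ ones.
   Context: $\mathbb Z_n=\mathbb Z/n\mathbb Z$ as a module over itself. A subsequence is a non-empty subfamily of terms in the original order. For non-empty $A,B\subseteq\mathbb Z_n$, a sequence $(x_1,\ldots,x_k)$ is an $(A,B)$-weighted zero-sum sequence if there exist $a_i\in A$, $b_i\in B$ with $\sum a_ix_i=0$ and $\sum b_ia_i=0$; it is an $A$-weighted zero-sum sequence if there exist $a_i\in A$ with $\sum a_ix_i=0$. $D_{A,B}(n)$ (resp. $E_{A,B}(n)$) is the least positive $k$ such that every sequence of length $k$ in $\mathbb Z_n$ has an $(A,B)$-weighted zero-sum subsequence (resp. of length $n$); $E_A(n)$ is the least positive $k$ such that every sequence of length $k$ has an $A$-weighted zero-sum subsequence of length $n$. A $D$-extremal sequence for $(A,B)$ is a sequence of length $D_{A,B}(n)-1$ with no $(A,B)$-weighted zero-sum subsequence; an $E$-extremal sequence for $(A,B)$ is a sequence of length $E_{A,B}(n)-1$ with no $(A,B)$-weighted zero-sum subsequence of length $n$; an $E$-extremal sequence for $A$ is a sequence of length $E_A(n)-1$ with no $A$-weighted zero-sum subsequence of length $n$. A translate of $(x_1,\ldots,x_k)$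 is $(x_1+x,\ldots,x_k+x)$ for some $x\in\mathbb Z_n$. Sequences $(x_1,\ldots,x_k)$ and $(y_1,\ldots,y_k)$ are equivalent if there exist a permutation $\sigma$ of $[1,k]$ and a unit $u\in\mathbb Z_n$ with $y_{\sigma(i)}=ux_i$ for all $i$. *)

theory Defs
  imports
    "HOL-Number_Theory.Residues"
    "HOL-Combinatorics.Permutations"
    "HOL-Library.Sublist"
begin

(* Elements of Z/nZ are the representatives 0, ..., n - 1; the library's residue_ring has these as
   its carrier and reduces every operation modulo n. *)
abbreviation Zn :: "nat \<Rightarrow> int ring" where
  "Zn n \<equiv> residue_ring (int n)"

abbreviation seqs :: "nat \<Rightarrow> int list set" where
  "seqs n \<equiv> lists (carrier (Zn n))"

definition lin_comb :: "nat \<Rightarrow> int list \<Rightarrow> int list \<Rightarrow> int" where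
  "lin_comb n ws xs = (\<Oplus>\<^bsub>Zn n\<^esub> i \<in> {..<length xs}. ws ! i \<otimes>\<^bsub>Zn n\<^esub> xs ! i)"

definition weighted_zero_sum :: "nat \<Rightarrow> int set \<Rightarrow> int list \<Rightarrow> bool" where
  "weighted_zero_sum n A xs \<longleftrightarrow>
     (\<exists>as \<in> lists A. length as = length xs \<and> lin_comb n as xs = \<zero>\<^bsub>Zn n\<^esub>)"

definition weighted_zero_sum2 :: "nat \<Rightarrow> int set \<Rightarrow> int set \<Rightarrow> int list \<Rightarrow> bool" where
  "weighted_zero_sum2 n A B xs \<longleftrightarrow>
     (\<exists>as \<in> lists A. \<exists>bs \<in> lists B.
        length as = length xs \<and> length bs = length xs \<and>
        lin_comb n as xs = \<zero>\<^bsub>Zn n\<^esub> \<and> lin_comb n bs as = \<zero>\<^bsub>Zn n\<^esub>)"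

definition has_zero_sum2 :: "nat \<Rightarrow> int set \<Rightarrow> int set \<Rightarrow> int list \<Rightarrow> bool" where
  "has_zero_sum2 n A B xs \<longleftrightarrow>
     (\<exists>ys. subseq ys xs \<and> ys \<noteq> [] \<and> weighted_zero_sum2 n A B ys)"

definition has_zero_sum2_n :: "nat \<Rightarrow> int set \<Rightarrow> int set \<Rightarrow> int list \<Rightarrow> bool" where
  "has_zero_sum2_n n A B xs \<longleftrightarrow>
     (\<exists>ys. subseq ys xs \<and> ys \<noteq> [] \<and> length ys = n \<and> weighted_zero_sum2 n A B ys)"

definition has_zero_sum_n :: "nat \<Rightarrow> int set \<Rightarrow> int list \<Rightarrow> bool" where
  "has_zero_sum_n n A xs \<longleftrightarrow>
     (\<exists>ys. subseq ys xs \<and> ys \<noteq> [] \<and> length ys = n \<and> weighted_zero_sum n A ys)"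

definition D_const2 :: "nat \<Rightarrow> int set \<Rightarrow> int set \<Rightarrow> nat" where
  "D_const2 n A B =
     (LEAST k. k > 0 \<and> (\<forall>xs \<in> seqs n. length xs = k \<longrightarrow> has_zero_sum2 n A B xs))"

definition E_const2 :: "nat \<Rightarrow> int set \<Rightarrow> int set \<Rightarrow> nat" where
  "E_const2 n A B =
     (LEAST k. k > 0 \<and> (\<forall>xs \<in> seqs n. length xs = k \<longrightarrow> has_zero_sum2_n n A B xs))"

definition E_const :: "nat \<Rightarrow> int set \<Rightarrow> nat" where
  "E_const n A =
     (LEAST k. k > 0 \<and> (\<forall>xs \<in> seqs n. length xs = k \<longrightarrow> has_zero_sum_n n A xs))"

definition D_extremal2 :: "nat \<Rightarrow> int set \<Rightarrow> int set \<Rightarrow> int list \<Rightarrow> bool" where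
  "D_extremal2 n A B xs \<longleftrightarrow>
     xs \<in> seqs n \<and> length xs = D_const2 n A B - 1 \<and> \<not> has_zero_sum2 n A B xs"

definition E_extremal2 :: "nat \<Rightarrow> int set \<Rightarrow> int set \<Rightarrow> int list \<Rightarrow> bool" where
  "E_extremal2 n A B xs \<longleftrightarrow>
     xs \<in> seqs n \<and> length xs = E_const2 n A B - 1 \<and> \<not> has_zero_sum2_n n A B xs"

definition E_extremal :: "nat \<Rightarrow> int set \<Rightarrow> int list \<Rightarrow> bool" where
  "E_extremal n A xs \<longleftrightarrow>
     xs \<in> seqs n \<and> length xs = E_const n A - 1 \<and> \<not> has_zero_sum_n n A xs"

definition translate_of :: "nat \<Rightarrow> int list \<Rightarrow> int list \<Rightarrow> bool" where
  "translate_of n ys xs \<longleftrightarrow> (\<exists>t \<in> carrier (Zn n). ys = map (\<lambda>x. x \<oplus>\<^bsub>Zn n\<^esub> t) xs)"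

definition equivalent_seqs :: "nat \<Rightarrow> int list \<Rightarrow> int list \<Rightarrow> bool" where
  "equivalent_seqs n xs ys \<longleftrightarrow>
     length xs = length ys \<and>
     (\<exists>\<sigma>. \<exists>u \<in> Units (Zn n). \<sigma> permutes {..<length xs} \<and>
        (\<forall>i < length xs. ys ! \<sigma> i = u \<otimes>\<^bsub>Zn n\<^esub> xs ! i))"

end

theory Submission
  imports Defs
begin

text \<open>With all weights equal to 1, the three notions of extremality say that the sequence has length
  \<open>2n - 2\<close> and no \<open>n\<close> terms with sum \<open>0\<close>, so the theorem is the Erdos--Ginzburg--Ziv theorem with its
  inverse. Translate so that \<open>0\<close> is a most frequent term, of multiplicity \<open>h\<close>; then any zero sum of
  between \<open>n - h\<close> and \<open>n\<close> nonzero terms can be padded with zeros. By the Kemperman--Scherk theorem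
  every \<open>n\<close> terms of multiplicity at most \<open>h\<close> contain a nonempty zero sum of size at most \<open>h\<close>, and
  collecting such zero sums one after the other hits the window. With one term fewer, the collection
  can only stop just below the window, and the \<open>n - 1\<close> terms left over are an equality case of
  Kemperman--Scherk, which forces them to be constant.\<close>

section \<open>The Kemperman--Scherk theorem modulo \<open>n\<close>\<close>

text \<open>Descent on \<open>card B\<close> by the Dyson e-transform, which here preserves the uniqueness of
  \<open>0 = 0 + 0\<close>.\<close>

lemma kemperman_scherk_mod:
  fixes n :: int
  assumes "n > 0" "A \<subseteq> {0..<n}" "B \<subseteq> {0..<n}" "0 \<in> A" "0 \<in> B"
    and "\<And>a b. a \<in> A \<Longrightarrow> b \<in> B \<Longrightarrow> n dvd a + b \<Longrightarrow> a = 0 \<and> b = 0"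
  shows "card A + card B \<le> card ((\<lambda>(a, b). (a + b) mod n) ` (A \<times> B)) + 1"
  using assms(2-)
proof (induction "card B" arbitrary: A B rule: less_induct)
  case (less B A)
  let ?sum = "\<lambda>A B. (\<lambda>(a, b). (a + b) mod n) ` (A \<times> B)"
  let ?sh = "\<lambda>e b. (b + e) mod n"
  have fin: "finite A" "finite B"
    using less.prems by (auto intro: finite_subset)
  have rep: "x mod n = x" if "x \<in> A \<union> B" for x
    using that less.prems by (auto simp: subset_iff)
  have only_zero: "a = 0 \<and> b = 0" if "a \<in> A" "b \<in> B" "n dvd a + b" for a b
    using less.prems(5) that by blast
  show ?case
  proof (cases "\<exists>e\<in>A. \<exists>b\<in>B. ?sh e b \<notin> A")
    case True
    then obtain e b0 where e: "e \<in> A" and b0: "b0 \<in> B" "?sh e b0 \<notin> A" by blast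
    \<comment> \<open>Every \<open>b\<close> in \<open>B\<close> with \<open>b + e\<close> outside
      \<open>A\<close> leaves \<open>B\<close> and its shift joins \<open>A\<close>, so the sum of
      the cardinalities is kept. \<open>B'\<close> loses \<open>b0\<close>, but keeps 0 because
      \<open>e\<close> lies in \<open>A\<close>.\<close>
    define A' where "A' = A \<union> ?sh e ` B"
    define B' where "B' = {b \<in> B. ?sh e b \<in> A}"
    have inj: "inj_on (?sh e) B"
    proof (rule inj_onI)
      fix x y assume xy: "x \<in> B" "y \<in> B" "?sh e x = ?sh e y"
      then have "[x = y] (mod n)"
        by (simp add: cong_def[symmetric] cong_add_rcancel)
      with xy rep show "x = y" by (auto simp: cong_def)
    qed
    have "A' = A \<union> ?sh e ` (B - B')"
      unfolding A'_def B'_def by auto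
    moreover have "card (A \<union> ?sh e ` (B - B')) = card A + card (?sh e ` (B - B'))"
      using fin by (intro card_Un_disjoint) (auto simp: B'_def)
    moreover have "card (?sh e ` (B - B')) = card (B - B')"
      using inj by (intro card_image) (auto intro: inj_on_subset)
    moreover have "card B = card B' + card (B - B')"
      using fin card_Un_disjoint[of B' "B - B'"]
      by (auto simp: B'_def Un_absorb1 finite_subset intro!: arg_cong[of _ _ card])
    ultimately have card: "card A + card B = card A' + card B'" by simp
    have "B' \<subset> B" using b0 by (auto simp: B'_def)
    then have lt: "card B' < card B" using fin by (simp add: psubset_card_mono)
    have sub: "?sum A' B' \<subseteq> ?sum A B"
    proof clarify
      fix a b assume ab: "a \<in> A'" "b \<in> B'"
      show "(a + b) mod n \<in> ?sum A B"
      proof (cases "a \<in> A")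
        case True
        with ab show ?thesis by (auto simp: B'_def)
      next
        case False
        with ab obtain c where c: "c \<in> B" "a = ?sh e c" by (auto simp: A'_def)
        \<comment> \<open>The exchange \<open>(e + c) + b = (e + b) + c\<close> leads back to
          \<open>A\<close> and \<open>B\<close>: \<open>e + b\<close> is in \<open>A\<close> since
          \<open>b\<close> is in \<open>B'\<close>.\<close>
        have "(a + b) mod n = (?sh e b + c) mod n"
          unfolding c by (simp add: mod_simps algebra_simps)
        with c ab show ?thesis by (auto simp: B'_def intro!: image_eqI[of _ _ "(?sh e b, c)"])
      qed
    qed
    have uniq: "a = 0 \<and> b = 0" if ab: "a \<in> A'" "b \<in> B'" "n dvd a + b" for a b
    proof (cases "a \<in> A")
      case True
      with ab show ?thesis using only_zero[of a b] by (auto simp: B'_def)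
    next
      case False
      with ab obtain c where c: "c \<in> B" "a = ?sh e c" by (auto simp: A'_def)
      \<comment> \<open>By the same exchange, uniqueness for \<open>A\<close> and \<open>B\<close>
        gives \<open>e + b = 0\<close> and \<open>c = 0\<close>. A second use, on \<open>e\<close>
        and \<open>b\<close>, gives \<open>e = b = 0\<close>.\<close>
      have "n dvd ?sh e b + c"
        using ab(3) unfolding c dvd_eq_mod_eq_0 by (simp add: mod_simps algebra_simps)
      with ab c have "?sh e b = 0" "c = 0"
        using only_zero[of "?sh e b" c] by (auto simp: B'_def)
      moreover from this have "n dvd e + b" by (simp add: dvd_eq_mod_eq_0 add.commute)
      ultimately show ?thesis
        using only_zero[of e b] e ab c by (auto simp: B'_def)
    qed
    have "card A' + card B' \<le> card (?sum A' B') + 1"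
    proof (rule less.hyps[OF lt])
      show "A' \<subseteq> {0..<n}" using less.prems assms(1) by (auto simp: A'_def)
      show "0 \<in> B'" using less.prems e rep by (auto simp: B'_def)
      show "0 \<in> A'" "B' \<subseteq> {0..<n}" using less.prems by (auto simp: A'_def B'_def)
    qed (use uniq in blast)+
    moreover have "card (?sum A' B') \<le> card (?sum A B)"
      using sub fin by (intro card_mono) auto
    ultimately show ?thesis using card by simp
  next
    case False
    then have closed: "?sh e b \<in> A" if "e \<in> A" "b \<in> B" for e b using that by blast
    have "b = 0" if b: "b \<in> B" for b
    proof -
      \<comment> \<open>\<open>A\<close> contains 0 and is closed under adding \<open>b\<close>, so
        it contains all multiples of \<open>b\<close>, among them \<open>(n - 1) * b = -b\<close>.
        Uniqueness for \<open>-b + b = 0\<close> then forces \<open>b = 0\<close>.\<close>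
      have mult: "(int k * b) mod n \<in> A" for k
      proof (induction k)
        case (Suc k)
        from closed[OF Suc b] show ?case by (simp add: mod_simps algebra_simps)
      qed (use less.prems in auto)
      from mult[of "nat (n - 1)"] have "((n - 1) * b) mod n \<in> A" using assms(1) by simp
      moreover have "n dvd ((n - 1) * b) mod n + b"
        unfolding dvd_eq_mod_eq_0 by (simp add: mod_simps algebra_simps)
      ultimately show ?thesis using only_zero b by blast
    qed
    with less.prems have "B = {0}" by auto
    moreover have "A \<subseteq> ?sum A {0}" using rep by force
    then have "card A \<le> card (?sum A {0})" using fin by (intro card_mono) auto
    ultimately show ?thesis by simp
  qed
qed

section \<open>Short sums, and zero sums with size in a given window\<close>

text \<open>The empty multiset counts, so 0 is always a short sum, as Kemperman--Scherk requires of
  its summands.\<close>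

definition short_sums :: "nat \<Rightarrow> nat \<Rightarrow> int multiset \<Rightarrow> int set" where
  "short_sums n h T = (\<lambda>M. \<Sum>\<^sub># M mod int n) ` {M. M \<subseteq># T \<and> size M \<le> h}"

lemma short_sums_subset: "n > 0 \<Longrightarrow> short_sums n h T \<subseteq> {0..<int n}"
  by (auto simp: short_sums_def)

text \<open>Serves to enlarge a sub-multiset of what remains after peeling off one copy of each
  value by some of the peeled copies.\<close>

lemma add_set_mset_subset:
  assumes "M \<subseteq># T - mset_set (set_mset T)" "A \<subseteq># mset_set (set_mset T)"
  shows "M + A \<subseteq># T"
proof -
  have "mset_set (set_mset T) \<subseteq># T"
    by (rule mset_set_set_mset_msubset)
  then show ?thesis
    using subset_mset.add_mono[OF assms] by simp
qed

text \<open>Peel off one copy of every element of \<open>T\<close>, and add the sets obtained in this way one by one: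
  the absence of short zero sums is the uniqueness that the Kemperman--Scherk theorem asks for.\<close>

lemma card_short_sums:
  assumes "n > 0" "set_mset T \<subseteq> {0..<int n}" "\<And>x. count T x \<le> h"
    and "\<And>M. M \<subseteq># T \<Longrightarrow> M \<noteq> {#} \<Longrightarrow> size M \<le> h \<Longrightarrow> \<not> int n dvd \<Sum>\<^sub># M"
  shows "size T + 1 \<le> card (short_sums n h T)"
  using assms(2-)
proof (induction h arbitrary: T)
  case 0
  then have "T = {#}" by (simp add: multiset_eqI)
  then show ?case by (simp add: short_sums_def)
next
  case (Suc h T)
  define A where "A = set_mset T"
  define T' where "T' = T - mset_set A"
  let ?B = "short_sums n h T'"
  have sub: "mset_set A \<subseteq># T" unfolding A_def by (rule mset_set_set_mset_msubset)
  have finA: "finite A" by (simp add: A_def)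
  have T'T: "T' \<subseteq># T" by (simp add: T'_def)
  have size: "size T = size T' + card A"
    using sub by (simp add: T'_def size_Diff_submset size_mset_mono le_add_diff_inverse2 flip: size_mset_set)
  have ext: "add_mset a M \<subseteq># T" if "M \<subseteq># T'" "a \<in> A" for a M
    using add_set_mset_subset[of M T "{#a#}"] that by (simp add: T'_def A_def)
  have "size T' + 1 \<le> card ?B"
  proof (rule Suc.IH)
    show "set_mset T' \<subseteq> {0..<int n}"
      using Suc.prems(1) set_mset_mono[OF T'T] by blast
    show "count T' x \<le> h" for x
    proof (cases "x \<in> A")
      case True
      then show ?thesis using Suc.prems(2)[of x] finA by (simp add: T'_def)
    next
      case False
      then show ?thesis by (simp add: T'_def A_def not_in_iff)
    qed
    show "\<not> int n dvd \<Sum>\<^sub># M" if "M \<subseteq># T'" "M \<noteq> {#}" "size M \<le> h" for M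
      using Suc.prems(3)[of M] that T'T by (meson le_SucI subset_mset.order_trans)
  qed
  \<comment> \<open>Including 0 makes the peeled copy optional: a sum from \<open>?B\<close> and
    \<open>insert 0 A\<close> uses at most \<open>h\<close> terms of \<open>T'\<close> and at most
    one peeled copy, hence at most \<open>Suc h\<close> terms of \<open>T\<close>.\<close>
  moreover have "card ?B + card (insert 0 A)
      \<le> card ((\<lambda>(a, b). (a + b) mod int n) ` (?B \<times> insert 0 A)) + 1"
  proof (rule kemperman_scherk_mod)
    show "?B \<subseteq> {0..<int n}" using assms(1) by (rule short_sums_subset)
    show "0 \<in> ?B" by (auto simp: short_sums_def intro!: image_eqI[of _ _ "{#}"])
    fix s b assume s: "s \<in> ?B" and b: "b \<in> insert 0 A" and dvd: "int n dvd s + b"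
    from s obtain M where M: "M \<subseteq># T'" "size M \<le> h" "s = \<Sum>\<^sub># M mod int n"
      by (auto simp: short_sums_def)
    from dvd have dvd': "int n dvd \<Sum>\<^sub># M + b"
      unfolding M dvd_eq_mod_eq_0 by (simp add: mod_simps)
    show "s = 0 \<and> b = 0"
    proof (cases "b \<in> A")
      case True
      with dvd' Suc.prems(3)[of "add_mset b M"] ext[OF M(1)] M(2) show ?thesis
        by (simp add: add.commute)
    next
      case False
      with b dvd' have "b = 0" "int n dvd \<Sum>\<^sub># M" by auto
      moreover have "M \<subseteq># T" using M(1) T'T by (rule subset_mset.order_trans)
      ultimately have "M = {#}" using Suc.prems(3)[of M] M(2) by fastforce
      with M \<open>b = 0\<close> show ?thesis by simp
    qed
  qed (use assms(1) Suc.prems(1) in \<open>auto simp: A_def\<close>)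
  moreover have "card (insert 0 A) = card A + 1"
  proof -
    have "0 \<notin> A" using Suc.prems(3)[of "{#0#}"] by (auto simp: A_def)
    then show ?thesis using finA by simp
  qed
  moreover have "(\<lambda>(a, b). (a + b) mod int n) ` (?B \<times> insert 0 A) \<subseteq> short_sums n (Suc h) T"
  proof clarify
    fix s b assume s: "s \<in> ?B" and b: "b \<in> insert 0 A"
    from s obtain M where M: "M \<subseteq># T'" "size M \<le> h" "s = \<Sum>\<^sub># M mod int n"
      by (auto simp: short_sums_def)
    show "(s + b) mod int n \<in> short_sums n (Suc h) T"
    proof (cases "b \<in> A")
      case True
      have "(s + b) mod int n = \<Sum>\<^sub># (add_mset b M) mod int n"
        unfolding M by (simp add: mod_simps add.commute)
      with ext[OF M(1) True] M(2) show ?thesis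
        unfolding short_sums_def by (intro image_eqI[of _ _ "add_mset b M"]) auto
    next
      case False
      with b M T'T show ?thesis
        unfolding short_sums_def
        by (intro image_eqI[of _ _ M]) (auto intro: subset_mset.order_trans)
    qed
  qed
  then have "card ((\<lambda>(a, b). (a + b) mod int n) ` (?B \<times> insert 0 A))
      \<le> card (short_sums n (Suc h) T)"
    using finite_subset[OF short_sums_subset[OF assms(1)]] by (intro card_mono) auto
  ultimately show ?case using size by simp
qed

text \<open>Otherwise there would be at least \<open>n + 1\<close> short sums among only
  \<open>n\<close> residues.\<close>

lemma short_zero_sum:
  assumes "n > 0" "set_mset T \<subseteq> {0..<int n}" "\<And>x. count T x \<le> h" "size T \<ge> n"
  obtains M where "M \<subseteq># T" "M \<noteq> {#}" "size M \<le> h" "int n dvd \<Sum>\<^sub># M"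
proof -
  have "card (short_sums n h T) \<le> n"
    using card_mono[OF _ short_sums_subset[OF assms(1)]] by fastforce
  with card_short_sums[of n T h] assms that show thesis by fastforce
qed

text \<open>Steps of size 1 to \<open>h\<close> cannot jump over \<open>h\<close> consecutive sizes.
  When the window moves up by one and \<open>R\<close> falls just below it, at least
  \<open>n\<close> terms are left outside \<open>R\<close>, so they contain a short zero sum to
  add.\<close>

lemma zero_sum_size_window:
  assumes "n > 0" "h > 0" "set_mset T \<subseteq> {0..<int n}" "\<And>x. count T x \<le> h"
    and "n + m \<le> size T + 1"
  obtains R where "R \<subseteq># T" "int n dvd \<Sum>\<^sub># R" "m \<le> size R" "size R < m + h"
proof -
  have "\<exists>R. R \<subseteq># T \<and> int n dvd \<Sum>\<^sub># R \<and> m \<le> size R \<and> size R < m + h"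
    using assms(5)
  proof (induction m)
    case 0
    then show ?case using assms(2) by (intro exI[of _ "{#}"]) auto
  next
    case (Suc m)
    then obtain R where R: "R \<subseteq># T" "int n dvd \<Sum>\<^sub># R" "m \<le> size R" "size R < m + h" by auto
    show ?case
    proof (cases "size R = m")
      case False
      with R show ?thesis by (intro exI[of _ R]) auto
    next
      case True
      define W where "W = T - R"
      have T: "T = W + R" using R(1) by (simp add: W_def)
      obtain M where M: "M \<subseteq># W" "M \<noteq> {#}" "size M \<le> h" "int n dvd \<Sum>\<^sub># M"
      proof (rule short_zero_sum[OF assms(1), of W h])
        show "set_mset W \<subseteq> {0..<int n}" using assms(3) by (simp add: T)
        show "count W x \<le> h" for x using assms(4)[of x] by (simp add: T)
        show "n \<le> size W" using Suc.prems True by (simp add: T)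
      qed
      have "size M > 0" using M(2) by (simp add: nonempty_has_size)
      with M R True show ?thesis by (intro exI[of _ "M + R"]) (auto simp: T)
    qed
  qed
  then show thesis using that by blast
qed

section \<open>The equality case: \<open>n - 1\<close> terms without short zero sums\<close>

text \<open>If the support \<open>A\<close> of \<open>W\<close> had two elements, then counting shows that the short sums of the rest of
  \<open>W\<close> are exactly the residues outside \<open>-A\<close>. They also avoid \<open>-(a + b)\<close> for distinct \<open>a, b\<close> in \<open>A\<close>,
  so \<open>A\<close> is closed under sums of distinct elements. As \<open>0\<close> is not in \<open>A\<close>, every element of \<open>A\<close> then
  has order 2, and a cyclic group has at most one such element.\<close>

lemma constant_of_no_short_zero_sum:
  assumes "n > 0" "h > 0" "set_mset W \<subseteq> {0..<int n}" "\<And>x. count W x \<le> h"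
    and "size W = n - 1"
    and free: "\<And>M. M \<subseteq># W \<Longrightarrow> M \<noteq> {#} \<Longrightarrow> size M \<le> h + 1 \<Longrightarrow> \<not> int n dvd \<Sum>\<^sub># M"
    and "x \<in># W" "y \<in># W"
  shows "x = y"
proof (rule ccontr)
  assume "x \<noteq> y"
  define A where "A = set_mset W"
  define V where "V = W - mset_set A"
  define B where "B = short_sums n (h - 1) V"
  have finA: "finite A" by (simp add: A_def)
  have A_range: "0 \<le> a \<and> a < int n" if "a \<in> A" for a using that assms(3) by (auto simp: A_def)
  have sub: "mset_set A \<subseteq># W" unfolding A_def by (rule mset_set_set_mset_msubset)
  have VW: "V \<subseteq># W" by (simp add: V_def)
  have size: "size W = size V + card A"
    using sub by (simp add: V_def size_Diff_submset size_mset_mono le_add_diff_inverse2 flip: size_mset_set)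
  have B_range: "B \<subseteq> {0..<int n}" unfolding B_def using assms(1) by (rule short_sums_subset)
  have cardB: "size V + 1 \<le> card B"
    unfolding B_def
  proof (rule card_short_sums[OF assms(1)])
    show "set_mset V \<subseteq> {0..<int n}"
      using assms(3) set_mset_mono[OF VW] by blast
    show "count V z \<le> h - 1" for z
      using assms(4)[of z] finA by (cases "z \<in> A") (simp_all add: V_def A_def not_in_iff)
    show "\<not> int n dvd \<Sum>\<^sub># M" if "M \<subseteq># V" "M \<noteq> {#}" "size M \<le> h - 1" for M
      using free[of M] that VW by (meson diff_le_self le_add1 order_trans subset_mset.order_trans)
  qed
  \<comment> \<open>Sizes up to \<open>h + 1\<close> arise here: at most \<open>h - 1\<close> terms
    of \<open>V\<close> together with one or two distinct elements of \<open>A\<close>.\<close>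
  have avoid: "(- \<Sum>\<^sub># N) mod int n \<notin> B"
    if "N \<subseteq># mset_set A" "N \<noteq> {#}" "size N \<le> 2" for N
  proof
    assume "(- \<Sum>\<^sub># N) mod int n \<in> B"
    then obtain M where M: "M \<subseteq># V" "size M \<le> h - 1" "(- \<Sum>\<^sub># N) mod int n = \<Sum>\<^sub># M mod int n"
      by (auto simp: B_def short_sums_def)
    then have "int n dvd \<Sum>\<^sub># M - (- \<Sum>\<^sub># N)"
      by (metis mod_eq_dvd_iff)
    then have "int n dvd \<Sum>\<^sub># (M + N)" by simp
    moreover have "M + N \<subseteq># W"
      using add_set_mset_subset[of M W N] M(1) that(1) by (simp add: V_def A_def)
    moreover have "size (M + N) \<le> h + 1" using that(3) M(2) assms(2) by simp
    ultimately show False using free[of "M + N"] that(2) by simp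
  qed
  define A' where "A' = (\<lambda>a. (- a) mod int n) ` A"
  have inj: "inj_on (\<lambda>a. (- a) mod int n) A"
  proof (rule inj_onI)
    fix a b assume ab: "a \<in> A" "b \<in> A" "(- a) mod int n = (- b) mod int n"
    then have "[a = b] (mod int n)"
      by (metis cong_def cong_minus_minus_iff)
    with ab A_range show "a = b" by (simp add: cong_def)
  qed
  have "A' \<inter> B = {}"
    using avoid[of "{#a#}" for a] finA by (auto simp: A'_def)
  moreover have "A' \<subseteq> {0..<int n}" using assms(1) by (auto simp: A'_def)
  moreover have "card A' = card A" using inj by (simp add: A'_def card_image)
  \<comment> \<open>The disjoint sets have at least
    \<open>card A + size V + 1 = size W + 1 = n\<close> elements together, so they fill all
    residues.\<close>
  ultimately have "card (A' \<union> B) \<ge> n"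
    using cardB size assms(1,5) finA B_range
    by (subst card_Un_disjoint) (auto simp: A'_def finite_subset)
  then have AB: "A' \<union> B = {0..<int n}"
    using \<open>A' \<subseteq> _\<close> B_range by (intro card_seteq) auto
  have closed: "(a + b) mod int n \<in> A" if "a \<in> A" "b \<in> A" "a \<noteq> b" for a b
  proof -
    have "{#a, b#} = mset_set {a, b}" using that by simp
    also have "\<dots> \<subseteq># mset_set A" using that finA by (intro subset_imp_msubset_mset_set) auto
    finally have "(- (a + b)) mod int n \<notin> B" using avoid[of "{#a, b#}"] by simp
    moreover have "(- (a + b)) mod int n \<in> A' \<union> B" unfolding AB using assms(1) by simp
    ultimately obtain c where c: "c \<in> A" "(- (a + b)) mod int n = (- c) mod int n"
      by (auto simp: A'_def)
    then have "[a + b = c] (mod int n)" by (metis cong_def cong_minus_minus_iff)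
    with c(1) A_range[of c] show ?thesis by (simp add: cong_def)
  qed
  have zero: "0 \<notin> A" using free[of "{#0#}"] by (auto simp: A_def)
  have diff: "(b - a) mod int n \<in> A" if ab: "a \<in> A" "b \<in> A" "a \<noteq> b" for a b
  proof -
    \<comment> \<open>Adding \<open>a\<close> repeatedly stays in \<open>A\<close> as long as the
      current element differs from \<open>a\<close>; reaching \<open>a\<close> would mean that the
      element before was 0. After \<open>n - 1\<close> additions the element is
      \<open>b - a\<close>.\<close>
    have "(b + int k * a) mod int n \<in> A \<and> (b + int k * a) mod int n \<noteq> a" for k
    proof (induction k)
      case 0
      then show ?case using ab A_range[of b] by simp
    next
      case (Suc k)
      let ?c = "(b + int k * a) mod int n"
      have eq: "(b + int (Suc k) * a) mod int n = (?c + a) mod int n"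
        by (simp add: mod_simps algebra_simps)
      have "?c + a \<noteq> a" using Suc zero by auto
      have "(?c + a) mod int n \<noteq> a"
      proof
        assume "(?c + a) mod int n = a"
        then have "[?c + a = 0 + a] (mod int n)" using A_range[OF ab(1)] by (simp add: cong_def)
        then have "[?c = 0] (mod int n)" by (simp only: cong_add_rcancel)
        then show False using Suc zero by (simp add: cong_def)
      qed
      with Suc closed[of ?c a] ab eq show ?case by simp
    qed
    from this[of "n - 1"] have "(b + int (n - 1) * a) mod int n \<in> A" by blast
    moreover have "(b + int (n - 1) * a) mod int n = (b - a) mod int n"
    proof -
      have "b + int (n - 1) * a = (b - a) + a * int n"
        using assms(1) by (simp add: of_nat_diff algebra_simps)
      then show ?thesis by (simp only: mod_mult_self1)
    qed
    ultimately show ?thesis by simp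
  qed
  \<comment> \<open>Otherwise \<open>b - a\<close> and \<open>a - b\<close> would be distinct
    elements of \<open>A\<close>, and their sum 0 would lie in \<open>A\<close>.\<close>
  have double: "int n dvd 2 * (b - a)" if ab: "a \<in> A" "b \<in> A" "a \<noteq> b" for a b
  proof (rule ccontr)
    assume ndvd: "\<not> int n dvd 2 * (b - a)"
    have "(b - a) mod int n \<noteq> (a - b) mod int n"
      using ndvd by (auto simp: mod_eq_dvd_iff)
    with closed[of "(b - a) mod int n" "(a - b) mod int n"] diff ab
    show False using zero by (simp add: mod_simps)
  qed
  have order2: "2 * a = int n" if ab: "a \<in> A" "b \<in> A" "a \<noteq> b" for a b
  proof -
    \<comment> \<open>\<open>b - a\<close> and \<open>b\<close> are distinct elements of
      \<open>A\<close> with difference \<open>a\<close>, so \<open>double\<close> yields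
      \<open>2 * a = 0\<close> modulo \<open>n\<close>; the range of \<open>a\<close> leaves only
      \<open>2 * a = n\<close>.\<close>
    have "(b - a) mod int n \<noteq> b"
    proof
      assume "(b - a) mod int n = b"
      then have "[b - a = b - 0] (mod int n)" using A_range[OF ab(2)] by (simp add: cong_def)
      then have "int n dvd a" by (simp add: cong_iff_dvd_diff)
      moreover have "a \<noteq> 0" using zero ab(1) by auto
      ultimately show False using A_range[OF ab(1)] zdvd_imp_le[of "int n" a] by auto
    qed
    then have "int n dvd 2 * (b - (b - a) mod int n)"
      using double[of "(b - a) mod int n" b] diff[OF ab] ab by auto
    moreover have "[2 * (b - (b - a) mod int n) = 2 * (b - (b - a))] (mod int n)"
      by (intro cong_mult cong_diff) (simp_all add: cong_def)
    ultimately have "int n dvd 2 * a" by (simp add: cong_dvd_iff)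
    then obtain k where k: "2 * a = int n * k" by auto
    moreover have "0 < 2 * a" "2 * a < 2 * int n" using A_range[OF ab(1)] zero ab(1) by (auto simp: less_le)
    ultimately have "0 < k" "k < 2"
      using assms(1) by (auto simp: zero_less_mult_iff mult.commute)
    then show ?thesis using k by simp
  qed
  have "x \<in> A" "y \<in> A" using assms by (auto simp: A_def)
  then have "2 * x = int n" "2 * y = int n" using order2[of x y] order2[of y x] \<open>x \<noteq> y\<close> by auto
  with \<open>x \<noteq> y\<close> show False by simp
qed

section \<open>Zero sums of exactly \<open>n\<close> terms: affine maps and padding\<close>

text \<open>The order-free form to which all three zero-sum conditions reduce when the weights are
  1, the \<open>D\<close> condition for lengths below \<open>2 * n\<close>.\<close>

definition has_zero_sum_mset :: "nat \<Rightarrow> int multiset \<Rightarrow> bool" where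
  "has_zero_sum_mset n S \<longleftrightarrow> (\<exists>M. M \<subseteq># S \<and> size M = n \<and> int n dvd \<Sum>\<^sub># M)"

lemma has_zero_sum_mset_mono:
  "has_zero_sum_mset n S \<Longrightarrow> S \<subseteq># T \<Longrightarrow> has_zero_sum_mset n T"
  unfolding has_zero_sum_mset_def using subset_mset.order_trans by blast

lemma sum_mset_affine_cong:
  "[\<Sum>\<^sub># (image_mset (\<lambda>x. (u * x + c) mod m) M) = u * \<Sum>\<^sub># M + int (size M) * c] (mod m)"
proof (induction M)
  case (add x M)
  have "[(u * x + c) mod m + \<Sum>\<^sub># (image_mset (\<lambda>x. (u * x + c) mod m) M)
      = (u * x + c) + (u * \<Sum>\<^sub># M + int (size M) * c)] (mod m)"
    using add by (intro cong_add) (simp_all add: cong_def)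
  then show ?case by (simp add: algebra_simps)
qed simp

text \<open>The constant contributes \<open>n * c\<close> to a sum of exactly \<open>n\<close>
  terms, which vanishes modulo \<open>n\<close>.\<close>

lemma has_zero_sum_mset_affine:
  assumes "has_zero_sum_mset n S"
  shows "has_zero_sum_mset n (image_mset (\<lambda>x. (u * x + c) mod int n) S)"
proof -
  let ?f = "\<lambda>x. (u * x + c) mod int n"
  from assms obtain M where M: "M \<subseteq># S" "size M = n" "int n dvd \<Sum>\<^sub># M"
    by (auto simp: has_zero_sum_mset_def)
  have "int n dvd \<Sum>\<^sub># (image_mset ?f M)"
    using sum_mset_affine_cong[of u c "int n" M] M by (simp add: cong_dvd_iff)
  with M show ?thesis
    unfolding has_zero_sum_mset_def
    by (intro exI[of _ "image_mset ?f M"]) (simp add: image_mset_subseteq_mono)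
qed

lemma mset_zero_one:
  assumes "set_mset M \<subseteq> {0, 1 :: int}"
  shows "\<Sum>\<^sub># M = int (count M 1)" "size M = count M 0 + count M 1"
  using assms by (induction M) auto

text \<open>Any \<open>n\<close> of these terms include at least one and at most
  \<open>n - 1\<close> ones, so their sum lies strictly between 0 and \<open>n\<close>.\<close>

lemma not_has_zero_sum_zeros_ones:
  assumes "n > 0"
  shows "\<not> has_zero_sum_mset n (replicate_mset (n - 1) 0 + replicate_mset (n - 1) 1)"
proof
  assume "has_zero_sum_mset n (replicate_mset (n - 1) 0 + replicate_mset (n - 1) 1)"
  then obtain M where M: "M \<subseteq># replicate_mset (n - 1) 0 + replicate_mset (n - 1) 1"
    "size M = n" "int n dvd \<Sum>\<^sub># M"
    by (auto simp: has_zero_sum_mset_def)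
  have count: "count M 0 \<le> n - 1" "count M 1 \<le> n - 1"
    using mset_subset_eq_count[OF M(1), of 0] mset_subset_eq_count[OF M(1), of 1] by auto
  have "set_mset M \<subseteq> {0, 1}"
    using set_mset_mono[OF M(1)] by (auto split: if_splits)
  then have "int n dvd int (count M 1)" "n = count M 0 + count M 1"
    using mset_zero_one[of M] M by auto
  moreover from this have "n dvd count M 1" by (simp only: int_dvd_int_iff)
  ultimately show False using count assms dvd_imp_le[of n "count M 1"] by linarith
qed

lemma has_zero_sum_mset_padding:
  assumes "R \<subseteq># filter_mset (\<lambda>x. x \<noteq> 0) S" "int n dvd \<Sum>\<^sub># R"
    and "size R \<le> n" "n \<le> size R + count S 0"
  shows "has_zero_sum_mset n S"
proof -
  have "filter_mset (\<lambda>x. x = 0) S = replicate_mset (count S 0) 0"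
    by (rule multiset_eqI) auto
  then have "S = filter_mset (\<lambda>x. x \<noteq> 0) S + replicate_mset (count S 0) 0"
    using multiset_partition[of S "\<lambda>x. x \<noteq> 0"] by simp
  moreover have "replicate_mset (n - size R) 0 \<subseteq># replicate_mset (count S 0) 0"
    using assms by (simp add: subseteq_mset_def)
  ultimately have "R + replicate_mset (n - size R) 0 \<subseteq># S"
    using assms(1) by (metis subset_mset.add_mono)
  then show ?thesis
    unfolding has_zero_sum_mset_def using assms
    by (intro exI[of _ "R + replicate_mset (n - size R) 0"]) simp
qed

lemma size_filter_neq: "size (filter_mset (\<lambda>x. x \<noteq> a) S) + count S a = size S"
  by (induction S) auto

section \<open>The Erdos--Ginzburg--Ziv theorem and its inverse when 0 is a most frequent
  term\<close>

lemma erdos_ginzburg_ziv_normalised: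
  assumes "n > 0" "set_mset S \<subseteq> {0..<int n}" "2 * n - 1 \<le> size S"
    and max: "\<And>x. count S x \<le> count S 0"
  shows "has_zero_sum_mset n S"
proof (cases "count S 0 \<ge> n")
  case True
  then show ?thesis using has_zero_sum_mset_padding[of "{#}" S n] by simp
next
  case False
  define T where "T = filter_mset (\<lambda>x. x \<noteq> 0) S"
  have "S \<noteq> {#}" using assms(1,3) by auto
  then obtain x where "x \<in># S" by auto
  then have "count S 0 > 0" using max[of x] by (metis gr0I leD count_greater_zero_iff)
  moreover have "set_mset T \<subseteq> {0..<int n}" using assms(2) by (auto simp: T_def)
  moreover have "count T x \<le> count S 0" for x using max[of x] by (simp add: T_def)
  \<comment> \<open>The length \<open>2 * n - 1\<close> is just enough for the window of sizes from
    \<open>n - count S 0\<close> to \<open>n - 1\<close>, all of which can be padded.\<close>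
  moreover have "n + (n - count S 0) \<le> size T + 1"
    using size_filter_neq[of 0 S] assms(3) False by (simp add: T_def)
  ultimately obtain R where "R \<subseteq># T" "int n dvd \<Sum>\<^sub># R" "n - count S 0 \<le> size R"
    "size R < n - count S 0 + count S 0"
    using zero_sum_size_window[OF assms(1), of "count S 0" T "n - count S 0"] by metis
  then show ?thesis using has_zero_sum_mset_padding[of R S n] False by (simp add: T_def)
qed

lemma inverse_erdos_ginzburg_ziv_normalised:
  assumes "n \<ge> 2" "set_mset S \<subseteq> {0..<int n}" "size S = 2 * n - 2"
    and max: "\<And>x. count S x \<le> count S 0" and no: "\<not> has_zero_sum_mset n S"
  obtains a where "coprime a (int n)"
    "S = replicate_mset (n - 1) 0 + replicate_mset (n - 1) a"
proof -
  define h where "h = count S 0"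
  define T where "T = filter_mset (\<lambda>x. x \<noteq> 0) S"
  have size_T: "size T + h = 2 * n - 2"
    using size_filter_neq[of 0 S] assms(3) by (simp add: T_def h_def)
  have h_less: "h < n"
    using has_zero_sum_mset_padding[of "{#}" S n] no by (force simp: h_def)
  have "S \<noteq> {#}" using assms(1,3) by auto
  then obtain x where "x \<in># S" by auto
  then have h_pos: "h > 0" using max[of x] by (metis gr0I leD count_greater_zero_iff h_def)
  have T_count: "count T x \<le> h" for x using max[of x] by (simp add: T_def h_def)
  have T_range: "set_mset T \<subseteq> {0..<int n}" using assms(2) by (auto simp: T_def)
  \<comment> \<open>One term fewer lowers the window by one, to the sizes from
    \<open>n - 1 - h\<close> to \<open>n - 2\<close>; only the lowest of them cannot be
    padded.\<close>
  have "n > 0" "n + (n - 1 - h) \<le> size T + 1" using size_T h_less by auto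
  then obtain R where R: "R \<subseteq># T" "int n dvd \<Sum>\<^sub># R" "n - 1 - h \<le> size R" "size R < n - 1 - h + h"
    using zero_sum_size_window[OF _ h_pos T_range T_count, of "n - 1 - h"] by metis
  have no_pad: "\<not> int n dvd \<Sum>\<^sub># M" if "M \<subseteq># T" "size M \<le> n" "n \<le> size M + h" for M
    using has_zero_sum_mset_padding[of M S n] no that by (auto simp: T_def h_def)
  have size_R: "size R = n - 1 - h"
  proof (rule ccontr)
    assume "size R \<noteq> n - 1 - h"
    then have "n \<le> size R + h" "size R \<le> n" using R(3,4) h_less by auto
    then show False using no_pad R(1,2) by blast
  qed
  define W where "W = T - R"
  have T: "T = W + R" using R(1) by (simp add: W_def)
  have size_W: "size W = n - 1" using size_T size_R h_less by (simp add: T)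
  have const: "x = y" if "x \<in># W" "y \<in># W" for x y
  proof (rule constant_of_no_short_zero_sum[OF _ h_pos _ _ size_W _ that])
    show "n > 0" "set_mset W \<subseteq> {0..<int n}" using assms(1) T_range by (auto simp: T)
    show "count W x \<le> h" for x using T_count[of x] by (simp add: T)
    \<comment> \<open>Joining \<open>R\<close> to such an \<open>M\<close> would give a zero sum of
      size between \<open>n - h\<close> and \<open>n\<close>, which can be padded.\<close>
    show "\<not> int n dvd \<Sum>\<^sub># M" if M: "M \<subseteq># W" "M \<noteq> {#}" "size M \<le> h + 1" for M
    proof -
      have "size M > 0" using M(2) by (simp add: nonempty_has_size)
      then have "\<not> int n dvd \<Sum>\<^sub># (M + R)"
        using M size_R h_less by (intro no_pad) (auto simp: T)
      then show ?thesis using R(2) by (simp add: dvd_add_left_iff)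
    qed
  qed
  have "W \<noteq> {#}" using size_W assms(1) by auto
  then obtain a where a: "a \<in># W" by auto
  have "set_mset W = {a}" using a const by blast
  then have W: "W = replicate_mset (n - 1) a"
    using set_mset_subset_singletonD[of W a] size_W by simp
  \<comment> \<open>The \<open>n - 1\<close> equal terms of \<open>W\<close> have multiplicity at
    most \<open>h < n\<close>, so \<open>h = n - 1\<close>; then \<open>R\<close> is empty and
    \<open>W\<close> is all of \<open>T\<close>.\<close>
  then have "n - 1 \<le> h" using T_count[of a] by (simp add: T)
  then have h: "h = n - 1" using h_less by simp
  then have T_eq: "T = replicate_mset (n - 1) a" using size_R by (simp add: T W)
  have "filter_mset (\<lambda>x. x = 0) S = replicate_mset h 0"
    unfolding h_def by (rule multiset_eqI) auto
  then have S: "S = replicate_mset (n - 1) 0 + replicate_mset (n - 1) a"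
    using multiset_partition[of S "\<lambda>x. x = 0"] T_eq by (simp add: T_def h)
  have "coprime a (int n)"
  proof (rule ccontr)
    assume "\<not> coprime a (int n)"
    \<comment> \<open>For \<open>d > 1\<close>, the \<open>k = n / d\<close> copies of
      \<open>a\<close> have sum \<open>n * b\<close> with \<open>0 < k < n\<close>, and the
      \<open>n - 1\<close> zeros suffice to pad them.\<close>
    define d where "d = nat (gcd a (int n))"
    have d: "int d = gcd a (int n)" by (simp add: d_def)
    then have "int d \<noteq> 1" using \<open>\<not> coprime a (int n)\<close> coprime_iff_gcd_eq_1 by metis
    moreover have "int d \<noteq> 0" using d assms(1) by simp
    ultimately have "d \<ge> 2" by simp
    have "int d dvd int n" "int d dvd a" using d by simp_all
    then obtain k b where k: "n = d * k" and b: "a = int d * b"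
      by (meson dvdE int_dvd_int_iff)
    have "0 < k" using k assms(1) by (cases k) auto
    moreover from this have "k < n" using k \<open>d \<ge> 2\<close> by simp
    moreover have "\<Sum>\<^sub># (replicate_mset k a) = int n * b" by (simp add: k b)
    moreover have "replicate_mset k a \<subseteq># T"
      using \<open>k < n\<close> by (simp add: T_eq subseteq_mset_def)
    ultimately show False using no_pad[of "replicate_mset k a"] h assms(1) by simp linarith
  qed
  then show thesis using S that by blast
qed

section \<open>The general case by translation\<close>

text \<open>Take for \<open>t\<close> a most frequent term: translation is injective on residues, so
  it preserves multiplicities.\<close>

lemma translate_most_frequent_to_zero:
  assumes "n > 0" "set_mset S \<subseteq> {0..<int n}" "S \<noteq> {#}"
  obtains t where "t \<in> {0..<int n}"
    "\<And>x. count (image_mset (\<lambda>x. (x - t) mod int n) S) x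
      \<le> count (image_mset (\<lambda>x. (x - t) mod int n) S) 0"
proof -
  obtain t where t: "t \<in># S" "\<And>x. x \<in># S \<Longrightarrow> count S x \<le> count S t"
    using Max_in[of "count S ` set_mset S"] Max_ge[of "count S ` set_mset S"] assms(3)
    by (smt (verit) finite_imageI finite_set_mset image_iff image_is_empty set_mset_eq_empty_iff)
  let ?f = "\<lambda>x. (x - t) mod int n"
  have inj: "inj_on ?f {0..<int n}"
  proof (rule inj_onI)
    fix x y assume xy: "x \<in> {0..<int n}" "y \<in> {0..<int n}" "?f x = ?f y"
    then have "[x - t = y - t] (mod int n)" by (simp add: cong_def)
    then have "[x = y] (mod int n)" by (simp add: cong_iff_dvd_diff)
    with xy show "x = y" by (simp add: cong_def)
  qed
  have count: "count (image_mset ?f S) (?f x) = count S x" if "x \<in># S" for x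
  proof -
    have "{y \<in> set_mset S. ?f x = ?f y} = {x}"
      using that inj assms(2) by (auto dest: inj_onD)
    then show ?thesis by (simp add: count_image_mset')
  qed
  show thesis
  proof
    show "t \<in> {0..<int n}" using t(1) assms(2) by blast
    fix y show "count (image_mset ?f S) y \<le> count (image_mset ?f S) 0"
    proof (cases "y \<in># image_mset ?f S")
      case True
      then obtain x where "x \<in># S" "y = ?f x" by auto
      with t count[of x] count[of t] show ?thesis by simp
    next
      case False
      then have "count (image_mset ?f S) y = 0" by (simp only: not_in_iff)
      then show ?thesis by (simp only: le0)
    qed
  qed
qed

lemma has_zero_sum_mset_translate_iff:
  assumes "set_mset S \<subseteq> {0..<int n}"
  shows "has_zero_sum_mset n (image_mset (\<lambda>x. (x - t) mod int n) S) \<longleftrightarrow> has_zero_sum_mset n S"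
proof
  assume "has_zero_sum_mset n (image_mset (\<lambda>x. (x - t) mod int n) S)"
  from has_zero_sum_mset_affine[OF this, of 1 t]
  have "has_zero_sum_mset n (image_mset (\<lambda>x. x mod int n) S)"
    by (simp add: multiset.map_comp comp_def mod_simps)
  moreover have "image_mset (\<lambda>x. x mod int n) S = image_mset (\<lambda>x. x) S"
    using assms by (intro image_mset_cong) (auto simp: subset_iff)
  ultimately show "has_zero_sum_mset n S" by simp
next
  assume "has_zero_sum_mset n S"
  from has_zero_sum_mset_affine[OF this, of 1 "- t"]
  show "has_zero_sum_mset n (image_mset (\<lambda>x. (x - t) mod int n) S)" by simp
qed

theorem erdos_ginzburg_ziv:
  assumes "n > 0" "set_mset S \<subseteq> {0..<int n}" "2 * n - 1 \<le> size S"
  shows "has_zero_sum_mset n S"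
proof -
  have "S \<noteq> {#}" using assms by auto
  then obtain t where "\<And>x. count (image_mset (\<lambda>x. (x - t) mod int n) S) x
      \<le> count (image_mset (\<lambda>x. (x - t) mod int n) S) 0"
    using translate_most_frequent_to_zero[OF assms(1,2)] by blast
  then have "has_zero_sum_mset n (image_mset (\<lambda>x. (x - t) mod int n) S)"
    using assms by (intro erdos_ginzburg_ziv_normalised) auto
  then show ?thesis using has_zero_sum_mset_translate_iff[OF assms(2)] by blast
qed

theorem inverse_erdos_ginzburg_ziv:
  assumes "n \<ge> 2" "set_mset S \<subseteq> {0..<int n}" "size S = 2 * n - 2" "\<not> has_zero_sum_mset n S"
  obtains t a where "t \<in> {0..<int n}" "coprime a (int n)"
    "image_mset (\<lambda>x. (x - t) mod int n) S = replicate_mset (n - 1) 0 + replicate_mset (n - 1) a"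
proof -
  have "n > 0" "S \<noteq> {#}" using assms by auto
  then obtain t where t: "t \<in> {0..<int n}" "\<And>x. count (image_mset (\<lambda>x. (x - t) mod int n) S) x
      \<le> count (image_mset (\<lambda>x. (x - t) mod int n) S) 0"
    using translate_most_frequent_to_zero[OF _ assms(2)] by blast
  have "\<not> has_zero_sum_mset n (image_mset (\<lambda>x. (x - t) mod int n) S)"
    using has_zero_sum_mset_translate_iff[OF assms(2)] assms(4) by blast
  moreover have "set_mset (image_mset (\<lambda>x. (x - t) mod int n) S) \<subseteq> {0..<int n}"
    "size (image_mset (\<lambda>x. (x - t) mod int n) S) = 2 * n - 2"
    using assms(1,3) by auto
  ultimately obtain a where "coprime a (int n)"
    "image_mset (\<lambda>x. (x - t) mod int n) S = replicate_mset (n - 1) 0 + replicate_mset (n - 1) a"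
    using inverse_erdos_ginzburg_ziv_normalised[OF assms(1) _ _ t(2)] by blast
  with t(1) that show thesis by blast
qed

section \<open>From multisets to subsequences with all weights 1\<close>

lemma mset_subseq: "subseq ys xs \<Longrightarrow> mset ys \<subseteq># mset xs"
proof (induction rule: list_emb.induct)
  case (list_emb_Cons xs ys y)
  then show ?case using subset_mset.order_trans[of "mset xs" "mset ys" "add_mset y (mset ys)"] by simp
qed simp_all

text \<open>Scanning \<open>xs\<close> from the left, a term is kept whenever the part of
  \<open>M\<close> still to be found contains it.\<close>

lemma subseq_of_msubset:
  assumes "M \<subseteq># mset xs"
  obtains ys where "subseq ys xs" "mset ys = M"
proof -
  have "\<exists>ys. subseq ys xs \<and> mset ys = M" using assms
  proof (induction xs arbitrary: M)
    case (Cons x xs)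
    show ?case
    proof (cases "x \<in># M")
      case True
      then obtain N where N: "M = add_mset x N" by (auto dest: multi_member_split)
      with Cons.prems have "N \<subseteq># mset xs" by simp
      with Cons.IH obtain ys where "subseq ys xs" "mset ys = N" by blast
      with N show ?thesis by (intro exI[of _ "x # ys"]) simp
    next
      case False
      with Cons.prems have "M \<subseteq># mset xs"
        by (metis diff_single_trivial mset.simps(2) subset_eq_diff_conv union_mset_add_mset_right add_mset_add_single)
      with Cons.IH obtain ys where "subseq ys xs" "mset ys = M" by blast
      then show ?thesis by (auto intro: exI[of _ ys])
    qed
  qed simp
  with that show thesis by blast
qed

lemma has_zero_sum_mset_iff_subseq:
  "has_zero_sum_mset n (mset xs) \<longleftrightarrow>
    (\<exists>ys. subseq ys xs \<and> length ys = n \<and> int n dvd sum_list ys)"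
proof
  assume "has_zero_sum_mset n (mset xs)"
  then obtain M where M: "M \<subseteq># mset xs" "size M = n" "int n dvd \<Sum>\<^sub># M"
    by (auto simp: has_zero_sum_mset_def)
  obtain ys where "subseq ys xs" "mset ys = M" using subseq_of_msubset[OF M(1)] .
  with M show "\<exists>ys. subseq ys xs \<and> length ys = n \<and> int n dvd sum_list ys"
    by (auto simp: sum_mset_sum_list)
next
  assume "\<exists>ys. subseq ys xs \<and> length ys = n \<and> int n dvd sum_list ys"
  then show "has_zero_sum_mset n (mset xs)"
    unfolding has_zero_sum_mset_def
    by (metis mset_subseq size_mset sum_mset_sum_list)
qed

lemma finsum_residue_ring:
  assumes "n \<ge> 2" "finite A" "f \<in> A \<rightarrow> carrier (Zn n)"
  shows "finsum (Zn n) f A = (\<Sum>i\<in>A. f i) mod int n"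
proof -
  interpret residues "int n" "Zn n" using assms(1) by unfold_locales auto
  show ?thesis using assms(2,3)
  proof (induction A rule: finite_induct)
    case empty
    then show ?case by (simp add: res_zero_eq)
  next
    case (insert x F)
    then show ?case by (simp add: finsum_insert Pi_iff res_add_eq mod_simps)
  qed
qed

lemma lin_comb_ones:
  assumes "n \<ge> 2" "xs \<in> seqs n"
  shows "lin_comb n (replicate (length xs) \<one>\<^bsub>Zn n\<^esub>) xs = sum_list xs mod int n"
proof -
  interpret residues "int n" "Zn n" using assms(1) by unfold_locales auto
  have mem: "xs ! i \<in> carrier (Zn n)" if "i < length xs" for i
    using assms(2) that by (simp add: in_lists_conv_set)
  have "lin_comb n (replicate (length xs) \<one>\<^bsub>Zn n\<^esub>) xs = (\<Oplus>\<^bsub>Zn n\<^esub> i \<in> {..<length xs}. xs ! i)"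
    unfolding lin_comb_def using mem by (intro finsum_cong') auto
  also have "\<dots> = (\<Sum>i<length xs. xs ! i) mod int n"
    using mem assms(1) by (intro finsum_residue_ring) auto
  also have "(\<Sum>i<length xs. xs ! i) = sum_list xs"
    by (simp add: sum_list_sum_nth lessThan_atLeast0)
  finally show ?thesis .
qed

lemma in_lists_singleton: "as \<in> lists {c} \<longleftrightarrow> as = replicate (length as) c"
  by (induction as) auto

lemma weighted_zero_sum_one:
  assumes "n \<ge> 2" "xs \<in> seqs n"
  shows "weighted_zero_sum n {\<one>\<^bsub>Zn n\<^esub>} xs \<longleftrightarrow> int n dvd sum_list xs"
proof -
  interpret residues "int n" "Zn n" using assms(1) by unfold_locales auto
  show ?thesis
    unfolding weighted_zero_sum_def dvd_eq_mod_eq_0 lin_comb_ones[OF assms, symmetric] res_zero_eq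
    by (metis in_lists_singleton length_replicate)
qed

text \<open>The second combination has the weights themselves as terms, so it adds up
  \<open>length xs\<close> ones.\<close>

lemma weighted_zero_sum2_one:
  assumes "n \<ge> 2" "xs \<in> seqs n"
  shows "weighted_zero_sum2 n {\<one>\<^bsub>Zn n\<^esub>} {\<one>\<^bsub>Zn n\<^esub>} xs \<longleftrightarrow> int n dvd sum_list xs \<and> n dvd length xs"
proof -
  interpret residues "int n" "Zn n" using assms(1) by unfold_locales auto
  let ?ones = "replicate (length xs) \<one>\<^bsub>Zn n\<^esub>"
  have "?ones \<in> seqs n" by (auto simp: in_lists_conv_set)
  from lin_comb_ones[OF assms(1) this]
  have len: "lin_comb n ?ones ?ones = int (length xs) mod int n"
    by (simp add: res_one_eq sum_list_replicate)
  have "weighted_zero_sum2 n {\<one>\<^bsub>Zn n\<^esub>} {\<one>\<^bsub>Zn n\<^esub>} xs \<longleftrightarrow>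
      lin_comb n ?ones xs = 0 \<and> lin_comb n ?ones ?ones = 0"
    unfolding weighted_zero_sum2_def res_zero_eq
    by (metis in_lists_singleton length_replicate)
  then show ?thesis
    unfolding lin_comb_ones[OF assms] len
    by (simp add: dvd_eq_mod_eq_0 flip: of_nat_mod)
qed

lemma subseq_seqs: "subseq ys xs \<Longrightarrow> xs \<in> seqs n \<Longrightarrow> ys \<in> seqs n"
  using set_mset_mono[OF mset_subseq, of ys xs] by (simp add: in_lists_conv_set subset_iff)

lemma has_zero_sum_n_one:
  assumes "n \<ge> 2" "xs \<in> seqs n"
  shows "has_zero_sum_n n {\<one>\<^bsub>Zn n\<^esub>} xs \<longleftrightarrow> has_zero_sum_mset n (mset xs)"
proof -
  have "ys \<noteq> []" if "length ys = n" for ys :: "int list" using that assms(1) by auto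
  then show ?thesis
    unfolding has_zero_sum_n_def has_zero_sum_mset_iff_subseq
    using weighted_zero_sum_one[OF assms(1)] subseq_seqs[OF _ assms(2)] by metis
qed

lemma has_zero_sum2_n_one:
  assumes "n \<ge> 2" "xs \<in> seqs n"
  shows "has_zero_sum2_n n {\<one>\<^bsub>Zn n\<^esub>} {\<one>\<^bsub>Zn n\<^esub>} xs \<longleftrightarrow> has_zero_sum_mset n (mset xs)"
proof -
  have "ys \<noteq> []" if "length ys = n" for ys :: "int list" using that assms(1) by auto
  then show ?thesis
    unfolding has_zero_sum2_n_def has_zero_sum_mset_iff_subseq
    using weighted_zero_sum2_one[OF assms(1)] subseq_seqs[OF _ assms(2)] by (metis dvd_refl)
qed

text \<open>The second weight condition says that \<open>n\<close> divides the length; below \<open>2n\<close> the only positive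
  multiple of \<open>n\<close> is \<open>n\<close> itself.\<close>

lemma has_zero_sum2_one:
  assumes "n \<ge> 2" "xs \<in> seqs n" "length xs < 2 * n"
  shows "has_zero_sum2 n {\<one>\<^bsub>Zn n\<^esub>} {\<one>\<^bsub>Zn n\<^esub>} xs \<longleftrightarrow> has_zero_sum_mset n (mset xs)"
proof -
  have "length ys = n \<longleftrightarrow> ys \<noteq> [] \<and> n dvd length ys" if "subseq ys xs" for ys
  proof -
    have "length ys < 2 * n" using list_emb_length[OF that] assms(3) by simp
    moreover have "length ys = n" if "ys \<noteq> []" "length ys = n * k" "length ys < 2 * n" for k
    proof -
      have "k \<noteq> 0" using that by (cases k) auto
      moreover have "k < 2" using that by simp
      ultimately have "k = 1" by simp
      with that show ?thesis by simp
    qed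
    ultimately show ?thesis using assms(1) unfolding dvd_def by fastforce
  qed
  then show ?thesis
    unfolding has_zero_sum2_def has_zero_sum_mset_iff_subseq
    using weighted_zero_sum2_one[OF assms(1)] subseq_seqs[OF _ assms(2)] by metis
qed

section \<open>The three constants and the form of the extremal sequences\<close>

lemma seqs_iff: "xs \<in> seqs n \<longleftrightarrow> set_mset (mset xs) \<subseteq> {0..<int n}"
  by (auto simp: residue_ring_def in_lists_conv_set)

text \<open>Computes all three constants at once. Agreement of \<open>H\<close> with the
  \<open>n\<close>-term condition is asked only below length \<open>2 * n\<close>, so that the
  \<open>D\<close> condition qualifies as well.\<close>

lemma Least_zero_sum_length:
  assumes "n \<ge> 2"
    and H: "\<And>xs. xs \<in> seqs n \<Longrightarrow> length xs < 2 * n \<Longrightarrow> H xs \<longleftrightarrow> has_zero_sum_mset n (mset xs)"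
  shows "(LEAST k. k > 0 \<and> (\<forall>xs\<in>seqs n. length xs = k \<longrightarrow> H xs)) = 2 * n - 1"
proof (rule Least_equality)
  have "H xs" if "xs \<in> seqs n" "length xs = 2 * n - 1" for xs
    using H[OF that(1)] erdos_ginzburg_ziv[of n "mset xs"] that assms(1)
    by (simp add: seqs_iff)
  then show "2 * n - 1 > 0 \<and> (\<forall>xs\<in>seqs n. length xs = 2 * n - 1 \<longrightarrow> H xs)"
    using assms(1) by simp
next
  fix k assume k: "k > 0 \<and> (\<forall>xs\<in>seqs n. length xs = k \<longrightarrow> H xs)"
  show "2 * n - 1 \<le> k"
  proof (rule ccontr)
    assume "\<not> 2 * n - 1 \<le> k"
    \<comment> \<open>A smaller \<open>k\<close> is refuted by a prefix of the extremal sequence,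
      since a zero sum in the prefix would be one in the whole.\<close>
    define xs :: "int list" where "xs = replicate (n - 1) 0 @ replicate (n - 1) 1"
    have len: "length (take k xs) = k" using \<open>\<not> _\<close> by (simp add: xs_def)
    have "xs \<in> seqs n" using assms(1) by (auto simp: seqs_iff xs_def)
    then have "take k xs \<in> seqs n" by (auto simp: in_lists_conv_set dest: in_set_takeD)
    then have "has_zero_sum_mset n (mset (take k xs))"
      using k H[of "take k xs"] len \<open>\<not> _\<close> by simp
    moreover have "mset (take k xs) \<subseteq># mset xs"
      by (metis append_take_drop_id mset_append mset_subset_eq_add_left)
    ultimately have "has_zero_sum_mset n (mset xs)" by (rule has_zero_sum_mset_mono)
    then show False using not_has_zero_sum_zeros_ones[of n] assms(1) by (simp add: xs_def)
  qed
qed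

text \<open>Two lists are rearrangements of each other exactly when their multisets agree, which
  absorbs the permutation of positions.\<close>

lemma equivalent_seqs_iff_mset:
  "equivalent_seqs n xs ys \<longleftrightarrow>
    (\<exists>u\<in>Units (Zn n). image_mset (\<lambda>x. u \<otimes>\<^bsub>Zn n\<^esub> x) (mset xs) = mset ys)"
proof
  assume "equivalent_seqs n xs ys"
  then obtain \<sigma> u where len: "length xs = length ys" and u: "u \<in> Units (Zn n)"
    and \<sigma>: "\<sigma> permutes {..<length xs}" "\<And>i. i < length xs \<Longrightarrow> ys ! \<sigma> i = u \<otimes>\<^bsub>Zn n\<^esub> xs ! i"
    by (auto simp: equivalent_seqs_def)
  have "permute_list \<sigma> ys = map (\<lambda>x. u \<otimes>\<^bsub>Zn n\<^esub> x) xs"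
    using len \<sigma> by (intro nth_equalityI) (simp_all add: permute_list_nth)
  then have "image_mset (\<lambda>x. u \<otimes>\<^bsub>Zn n\<^esub> x) (mset xs) = mset (permute_list \<sigma> ys)" by simp
  also have "\<dots> = mset ys" using \<sigma>(1) len by (intro mset_permute_list) simp
  finally show "\<exists>u\<in>Units (Zn n). image_mset (\<lambda>x. u \<otimes>\<^bsub>Zn n\<^esub> x) (mset xs) = mset ys"
    using u by blast
next
  assume "\<exists>u\<in>Units (Zn n). image_mset (\<lambda>x. u \<otimes>\<^bsub>Zn n\<^esub> x) (mset xs) = mset ys"
  then obtain u where u: "u \<in> Units (Zn n)" "mset (map (\<lambda>x. u \<otimes>\<^bsub>Zn n\<^esub> x) xs) = mset ys"
    by auto
  from mset_eq_permutation[OF u(2)] obtain p where p: "p permutes {..<length ys}"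
    "permute_list p ys = map (\<lambda>x. u \<otimes>\<^bsub>Zn n\<^esub> x) xs" by blast
  have len: "length xs = length ys" using mset_eq_length[OF u(2)] by simp
  have "ys ! p i = u \<otimes>\<^bsub>Zn n\<^esub> xs ! i" if "i < length xs" for i
    using arg_cong[OF p(2), of "\<lambda>zs. zs ! i"] permute_list_nth[OF p(1)] that len by simp
  with u(1) p(1) len show "equivalent_seqs n xs ys"
    unfolding equivalent_seqs_def by auto
qed

lemma zero_sum_free_iff_translate_equivalent:
  assumes "n \<ge> 2" "S \<in> seqs n"
  shows "length S = 2 * n - 2 \<and> \<not> has_zero_sum_mset n (mset S) \<longleftrightarrow>
    (\<exists>T\<in>seqs n. translate_of n S T \<and>
      equivalent_seqs n T (replicate (n - 1) \<zero>\<^bsub>Zn n\<^esub> @ replicate (n - 1) \<one>\<^bsub>Zn n\<^esub>))"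
    (is "?lhs \<longleftrightarrow> ?rhs")
proof -
  interpret residues "int n" "Zn n" using assms(1) by unfold_locales auto
  have carrier: "carrier (Zn n) = {0..<int n}" by (auto simp: residue_ring_def)
  show ?thesis
  proof
    assume ?lhs
    then obtain t a where t: "t \<in> {0..<int n}" and a: "coprime a (int n)"
      and eq: "image_mset (\<lambda>x. (x - t) mod int n) (mset S)
        = replicate_mset (n - 1) 0 + replicate_mset (n - 1) a"
      using inverse_erdos_ginzburg_ziv[of n "mset S"] assms unfolding seqs_iff by auto
    define T where "T = map (\<lambda>x. (x - t) mod int n) S"
    have seqs: "T \<in> seqs n" using assms(1) by (auto simp: T_def seqs_iff)
    have "S = map (\<lambda>x. x \<oplus>\<^bsub>Zn n\<^esub> t) T"
    proof -
      have "(x - t) mod int n \<oplus>\<^bsub>Zn n\<^esub> t = x" if "x \<in> set S" for x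
        using assms(2) that by (auto simp: seqs_iff subset_iff res_add_eq mod_simps)
      then show ?thesis by (simp add: T_def comp_def map_idI)
    qed
    then have translate: "translate_of n S T" using t carrier by (auto simp: translate_of_def)
    obtain v where v: "[a * v = 1] (mod int n)"
      using cong_solve_coprime_int[OF a] by blast
    \<comment> \<open>The inverse of \<open>a\<close>, reduced to a representative, turns the copies
      of \<open>a\<close> into ones and fixes the zeros.\<close>
    define u where "u = v mod int n"
    have ua: "(u * a) mod int n = 1"
      using v assms(1) by (simp add: u_def cong_def mod_simps mult.commute)
    then have "u \<noteq> 0" using assms(1) by auto
    moreover have "0 \<le> u" "u < int n" using assms(1) by (auto simp: u_def)
    moreover have "coprime u (int n)"
      using ua assms(1) by (intro coprime_iff_invertible_int[THEN iffD2]) (auto simp: cong_def)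
    ultimately have "u \<in> Units (Zn n)" by (simp add: res_units_eq)
    then have equivalent: "equivalent_seqs n T (replicate (n - 1) \<zero>\<^bsub>Zn n\<^esub> @ replicate (n - 1) \<one>\<^bsub>Zn n\<^esub>)"
      unfolding equivalent_seqs_iff_mset
      using eq ua by (intro bexI[of _ u]) (simp_all add: T_def res_mult_eq res_zero_eq res_one_eq)
    show ?rhs using seqs translate equivalent by blast
  next
    assume ?rhs
    then obtain T t u where T: "T \<in> seqs n" and S: "S = map (\<lambda>x. x \<oplus>\<^bsub>Zn n\<^esub> t) T"
      and u: "image_mset (\<lambda>x. u \<otimes>\<^bsub>Zn n\<^esub> x) (mset T)
        = mset (replicate (n - 1) \<zero>\<^bsub>Zn n\<^esub> @ replicate (n - 1) \<one>\<^bsub>Zn n\<^esub>)"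
      unfolding translate_of_def equivalent_seqs_iff_mset by blast
    have image: "image_mset (\<lambda>x. (u * x + 0) mod int n) (mset T)
        = replicate_mset (n - 1) 0 + replicate_mset (n - 1) 1"
      using u by (simp add: res_mult_eq res_zero_eq res_one_eq)
    \<comment> \<open>Multiplication by \<open>u\<close> would carry a zero sum of \<open>n\<close>
      terms of \<open>T\<close> to one among the zeros and ones.\<close>
    have "\<not> has_zero_sum_mset n (mset T)"
      using has_zero_sum_mset_affine[of n "mset T" u 0] not_has_zero_sum_zeros_ones[of n] assms(1)
      unfolding image by auto
    moreover have "mset S = image_mset (\<lambda>x. (x - (- t)) mod int n) (mset T)"
      by (simp add: S res_add_eq)
    ultimately have "\<not> has_zero_sum_mset n (mset S)"
      using has_zero_sum_mset_translate_iff[of "mset T" n "- t"] T by (simp only: seqs_iff) simp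
    moreover have "length S = 2 * n - 2"
      using arg_cong[OF image, of size] by (simp add: S)
    ultimately show ?lhs by blast
  qed
qed

theorem theorem3:
  fixes n :: nat and S :: "int list"
  assumes "n \<ge> 2" and "S \<in> seqs n"
  shows "(D_extremal2 n {\<one>\<^bsub>Zn n\<^esub>} {\<one>\<^bsub>Zn n\<^esub>} S \<longleftrightarrow> E_extremal2 n {\<one>\<^bsub>Zn n\<^esub>} {\<one>\<^bsub>Zn n\<^esub>} S)
    \<and> (E_extremal2 n {\<one>\<^bsub>Zn n\<^esub>} {\<one>\<^bsub>Zn n\<^esub>} S \<longleftrightarrow> E_extremal n {\<one>\<^bsub>Zn n\<^esub>} S)
    \<and> (E_extremal n {\<one>\<^bsub>Zn n\<^esub>} S \<longleftrightarrow>
         (\<exists>T \<in> seqs n. translate_of n S T \<and>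
            equivalent_seqs n T (replicate (n - 1) \<zero>\<^bsub>Zn n\<^esub> @ replicate (n - 1) \<one>\<^bsub>Zn n\<^esub>)))"
proof -
  \<comment> \<open>The condition with which each of the four statements is compared.\<close>
  let ?free = "length S = 2 * n - 2 \<and> \<not> has_zero_sum_mset n (mset S)"
  have "D_const2 n {\<one>\<^bsub>Zn n\<^esub>} {\<one>\<^bsub>Zn n\<^esub>} = 2 * n - 1"
    unfolding D_const2_def by (intro Least_zero_sum_length has_zero_sum2_one assms(1))
  then have "D_extremal2 n {\<one>\<^bsub>Zn n\<^esub>} {\<one>\<^bsub>Zn n\<^esub>} S \<longleftrightarrow> ?free"
    using has_zero_sum2_one[OF assms] assms by (auto simp: D_extremal2_def)
  moreover have "E_const2 n {\<one>\<^bsub>Zn n\<^esub>} {\<one>\<^bsub>Zn n\<^esub>} = 2 * n - 1"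
    unfolding E_const2_def by (intro Least_zero_sum_length has_zero_sum2_n_one assms(1))
  then have "E_extremal2 n {\<one>\<^bsub>Zn n\<^esub>} {\<one>\<^bsub>Zn n\<^esub>} S \<longleftrightarrow> ?free"
    using has_zero_sum2_n_one[OF assms] assms by (auto simp: E_extremal2_def)
  moreover have "E_const n {\<one>\<^bsub>Zn n\<^esub>} = 2 * n - 1"
    unfolding E_const_def by (intro Least_zero_sum_length has_zero_sum_n_one assms(1))
  then have "E_extremal n {\<one>\<^bsub>Zn n\<^esub>} S \<longleftrightarrow> ?free"
    using has_zero_sum_n_one[OF assms] assms by (auto simp: E_extremal_def)
  ultimately show ?thesis
    using zero_sum_free_iff_translate_equivalent[OF assms] by blast
qed

end
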